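(* For every $d\in\{5,6,7\}$ and every even integer $\ell>2$, except when $\ell=4$ and $d\in\{6,7\}$, there is a cracked graceful permutation of length $2\ell-1$ with crack $\ell-2$ whose first element is $\ell+1$, whose last element is $\ell$, and whose first absolute difference is $d$.
   Context: A cracked graceful permutation of length $n$ is an arrangement $(a_1,\dots,a_n)$ of $n$ distinct integers from $\{0,1,\dots,n\}$ such that its absolute differences $|a_{i+1}-a_i|$ ($1\le i\le n-1$) are exactly the integers $\{1,\dots,n-1\}$; the missing element of $\{0,\dots,n\}$ is the crack. The first absolute difference is $|a_2-a_1|$. *)

theory Defs
  imports Main
begin

definition absdiff :: "nat \<Rightarrow> nat \<Rightarrow> nat" where
  "absdiff a b = (if a \<le> b then b - a else a - b)"

definition cracked_graceful :: "nat \<Rightarrow> nat list \<Rightarrow> bool" where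
  "cracked_graceful n xs \<longleftrightarrow>
     length xs = n \<and> distinct xs \<and> set xs \<subseteq> {0..n} \<and>
     {absdiff (xs ! (i+1)) (xs ! i) | i. i + 1 < n} = {1..n-1}"

definition has_crack :: "nat \<Rightarrow> nat list \<Rightarrow> nat \<Rightarrow> bool" where
  "has_crack n xs c \<longleftrightarrow> c \<in> {0..n} \<and> c \<notin> set xs"

end

theory Submission
  imports Defs
begin

text \<open>
  Subtracting \<open>l\<close> from every entry turns the task into finding a path through all integers of
  \<open>[-l, l - 1]\<close> except \<open>-2\<close>, from \<open>1\<close> to \<open>0\<close>, whose steps have all the sizes \<open>1, \<dots>, 2 * l - 2\<close>.
  For large \<open>l\<close> such a path is assembled as follows.  From the centre it zigzags outwards
  periodically, four steps and two new integers on either side at a time, until the distance from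
  the centre is about \<open>l / 2\<close>; there an irregular passage skips the step sizes close to \<open>l\<close>; then
  it zigzags outwards again, up to the ends of the interval, and finally uses the skipped sizes for
  jumps back to the centre.  The period length is fixed, so raising \<open>l\<close> by 4 adds one period to each of
  the two zigzags, moves the irregular passage by 2 and the outer end by 4.  For each \<open>d\<close> and each
  residue of \<open>l\<close> modulo 4, the irregular pieces were found by a computer search; whether they fit
  together is a finite check that does not depend on \<open>l\<close>.  The few remaining pairs are given explicitly.
\<close>

section \<open>Paths centred at the origin\<close>

text \<open>Phrased with \<open>map2\<close> so that concrete lists can be evaluated; the indexed
  form follows in \<open>gaps_conv_nth\<close>.\<close>

definition gaps :: "int list \<Rightarrow> int set" where
  "gaps zs = set (map2 (\<lambda>x y. \<bar>x - y\<bar>) zs (tl zs))"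

definition centred :: "nat \<Rightarrow> nat \<Rightarrow> int list \<Rightarrow> bool" where
  "centred d l zs \<longleftrightarrow>
     length zs = 2 * l - 1 \<and> hd zs = 1 \<and> last zs = 0 \<and> \<bar>zs ! 1 - 1\<bar> = int d \<and>
     (\<forall>z \<in> {- int l .. int l - 1}. z = -2 \<or> z \<in> set zs) \<and>
     (\<forall>g \<in> {1 .. 2 * int l - 2}. g \<in> gaps zs)"

lemma gaps_conv_nth: "gaps zs = {\<bar>zs ! (i + 1) - zs ! i\<bar> | i. i + 1 < length zs}"
  unfolding gaps_def set_zip set_map
  by (simp add: nth_tl case_prod_beta setcompr_eq_image image_image less_diff_conv abs_minus_commute
      cong: conj_cong)

lemma gaps_infix: "gaps ys \<subseteq> gaps (xs @ ys @ zs)"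
proof
  fix g assume "g \<in> gaps ys"
  then obtain i where "i + 1 < length ys" "g = \<bar>ys ! (i + 1) - ys ! i\<bar>"
    by (auto simp: gaps_conv_nth)
  then show "g \<in> gaps (xs @ ys @ zs)"
    by (auto simp: gaps_conv_nth nth_append intro!: exI[of _ "length xs + i"])
qed

text \<open>Pigeonhole, twice: \<open>2 * l - 1\<close> entries must cover as many values, and
  \<open>2 * l - 2\<close> steps as many sizes. So both inclusions in \<open>centred\<close> are
  equalities and no entry repeats.\<close>

lemma cracked_graceful_of_centred:
  fixes zs :: "int list" and l d :: nat
  assumes "centred d l zs" and l: "l > 2"
  defines "xs \<equiv> map (\<lambda>z. nat (z + int l)) zs"
  shows "cracked_graceful (2*l - 1) xs \<and> has_crack (2*l - 1) xs (l - 2)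
           \<and> xs ! 0 = l + 1 \<and> last xs = l \<and> absdiff (xs ! 1) (xs ! 0) = d"
proof -
  have len: "length zs = 2 * l - 1" and ends: "hd zs = 1" "last zs = 0" "\<bar>zs ! 1 - 1\<bar> = int d"
    and cover: "{- int l .. int l - 1} - {-2} \<subseteq> set zs" and gap: "{1 .. 2 * int l - 2} \<subseteq> gaps zs"
    using assms(1) by (auto simp: centred_def)
  have "card ({- int l .. int l - 1} - {-2}) = length zs"
    using l len by (simp add: card_Diff_singleton_if)
  with cover have set_zs: "set zs = {- int l .. int l - 1} - {-2}"
    by (metis List.finite_set card_length card_seteq)
  with \<open>card _ = length zs\<close> have "distinct zs" by (simp add: card_distinct)
  have nonempty: "zs \<noteq> []" using l len by auto
  \<comment> \<open>Ensures that \<open>nat\<close> never truncates, so the shift preserves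
    differences.\<close>
  have nonneg: "0 \<le> zs ! i + int l" if "i < length zs" for i
    using set_zs that nth_mem[of i zs] by auto
  have "inj_on (\<lambda>z. nat (z + int l)) (set zs)"
    unfolding set_zs by (auto simp: inj_on_def)
  with \<open>distinct zs\<close> have dist: "distinct xs" by (simp add: xs_def distinct_map)
  have range: "set xs \<subseteq> {0..2 * l - 1}" using l by (auto simp: xs_def set_zs)
  have crack: "l - 2 \<notin> set xs"  using l by (auto simp: xs_def set_zs)
  have step: "int (absdiff (xs ! j) (xs ! i)) = \<bar>zs ! j - zs ! i\<bar>"
    if "i < length zs" "j < length zs" for i j
    using nonneg[of i] nonneg[of j] that by (auto simp: xs_def absdiff_def)
  let ?D = "{absdiff (xs ! (i+1)) (xs ! i) | i. i + 1 < 2 * l - 1}"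
  have D_eq: "?D = (\<lambda>i. absdiff (xs ! (i+1)) (xs ! i)) ` {..<2 * l - 2}"
    using l by (auto simp: image_iff)
  have "{1..2 * l - 2} \<subseteq> ?D"
  proof
    fix g assume "g \<in> {1..2 * l - 2}"
    then have "int g \<in> gaps zs" using gap l by auto
    then obtain i where i: "i + 1 < length zs" "int g = \<bar>zs ! (i + 1) - zs ! i\<bar>"
      by (auto simp: gaps_conv_nth)
    with step[of i "i + 1"] have "g = absdiff (xs ! (i+1)) (xs ! i)" by simp
    with i len show "g \<in> ?D" by auto
  qed
  moreover have "finite ?D" "card ?D \<le> 2 * l - 2"
    unfolding D_eq using card_image_le[of "{..<2 * l - 2}"] by auto
  ultimately have "?D = {1..2 * l - 1 - 1}" using card_seteq[of ?D "{1..2 * l - 2}"] l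
    by (simp add: numeral_2_eq_2)
  then have "cracked_graceful (2*l - 1) xs"
    using dist range len by (simp add: cracked_graceful_def xs_def)
  moreover have "xs ! 0 = l + 1" "last xs = l"
    using ends nonempty by (auto simp: xs_def hd_conv_nth last_map nat_add_distrib)
  moreover have "int (absdiff (xs ! 1) (xs ! 0)) = int d"
    using step[of 0 1] ends nonempty len l by (simp add: hd_conv_nth)
  ultimately show ?thesis using crack by (simp add: has_crack_def)
qed

section \<open>Paths growing with a parameter\<close>

text \<open>A pair \<open>(c, k)\<close> stands for the integer \<open>c + k * t\<close>, which depends on a parameter \<open>t\<close>.\<close>

type_synonym line = "(int \<times> int) list"

definition inst :: "nat \<Rightarrow> line \<Rightarrow> int list" where
  "inst t xs = map (\<lambda>(c, k). c + k * int t) xs"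

text \<open>The sign of a difference may depend on \<open>t\<close>, so both orientations are kept;
  whichever is nonnegative at a given \<open>t\<close> is the step size.\<close>

definition steps :: "line \<Rightarrow> (int \<times> int) set" where
  "steps xs = set (map2 (\<lambda>(c, k) (c', k'). (c - c', k - k')) xs (tl xs))
            \<union> set (map2 (\<lambda>(c, k) (c', k'). (c' - c, k' - k)) xs (tl xs))"

text \<open>The inner zigzag repeats \<open>F\<close> for \<open>t = 0, \<dots>, m - 1\<close> and the outer one repeats \<open>G\<close> for
  \<open>t = m, \<dots>, 2 * m - 1\<close>, so the passage \<open>M\<close> between them is taken at \<open>t = m\<close> and the end \<open>E\<close> at
  \<open>t = 2 * m\<close>.  Below, \<open>M\<close> and \<open>E\<close> start with the first entry of the copy of \<open>F\<close> or \<open>G\<close> that would come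
  next, so every copy is followed by the same step, also for the last one.\<close>

definition grow :: "line \<Rightarrow> line \<Rightarrow> line \<Rightarrow> line \<Rightarrow> line \<Rightarrow> nat \<Rightarrow> int list" where
  "grow P F M G E m =
     inst 0 P @ concat (map (\<lambda>t. inst t F) [0..<m]) @
     inst m M @ concat (map (\<lambda>t. inst t G) [m..<2*m]) @ inst (2*m) E"

text \<open>The integers on one side (\<open>s\<close> is their sign): the inner zigzag starts after \<open>a\<close>, the outer
  one after \<open>b + 2 * m\<close>, and the last integer is \<open>n + 4 * m\<close>.\<close>

definition side :: "int \<Rightarrow> int \<Rightarrow> int \<Rightarrow> int \<Rightarrow> line \<Rightarrow> line \<Rightarrow> line \<Rightarrow> line \<Rightarrow> line \<Rightarrow> bool" where
  "side s a b n P F M G E \<longleftrightarrow>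
     (\<forall>c \<in> {0..a}. s * c = -2 \<or> (s * c, 0) \<in> set P \<union> set E) \<and>
     (\<forall>c \<in> {a+1..a+2}. (s * c, 2 * s) \<in> set F) \<and>
     (\<forall>c \<in> {a+1..b}. (s * c, 2 * s) \<in> set M) \<and>
     (\<forall>c \<in> {b+1..b+2}. (s * c, 2 * s) \<in> set G) \<and>
     (\<forall>c \<in> {b+1..n}. (s * c, 2 * s) \<in> set E)"

text \<open>Since c + k(t + 1) = (c + k) + kt, the head of copy \<open>t + 1\<close> is again a line
  in \<open>t\<close>.\<close>

definition next_copy :: "line \<Rightarrow> int \<times> int" where
  "next_copy F = (fst (hd F) + snd (hd F), snd (hd F))"

text \<open>The five clauses are consecutive bands of step sizes. \<open>E\<close> is taken at
  \<open>2 * m\<close>, so slope 2 there shifts by \<open>4 * m\<close>, exactly as slope 4 does in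
  \<open>M\<close>.\<close>

definition all_steps :: "int \<Rightarrow> int \<Rightarrow> int \<Rightarrow> line \<Rightarrow> line \<Rightarrow> line \<Rightarrow> line \<Rightarrow> line \<Rightarrow> bool" where
  "all_steps p q n P F M G E \<longleftrightarrow>
     (\<forall>c \<in> {1..p}. (c, 0) \<in> steps (P @ [(fst (hd F), 0)]) \<union> steps (M @ [hd G]) \<union> steps E) \<and>
     (\<forall>c \<in> {p+1..p+4}. (c, 4) \<in> steps (F @ [next_copy F])) \<and>
     (\<forall>c \<in> {p+1..q}. (c, 4) \<in> steps (M @ [hd G]) \<or> (c, 2) \<in> steps E) \<and>
     (\<forall>c \<in> {q+1..q+4}. (c, 4) \<in> steps (G @ [next_copy G])) \<and>
     (\<forall>c \<in> {q+1..n}. (c, 4) \<in> steps E)"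

definition fits :: "nat \<Rightarrow> nat \<Rightarrow> int \<Rightarrow> int \<Rightarrow> int \<Rightarrow> int \<Rightarrow> int \<Rightarrow> int \<Rightarrow>
    line \<Rightarrow> line \<Rightarrow> line \<Rightarrow> line \<Rightarrow> line \<Rightarrow> bool" where
  "fits d l a b a' b' p q P F M G E \<longleftrightarrow>
     length P + length M + length E = 2 * l - 1 \<and> length F = 4 \<and> length G = 4 \<and>
     0 \<le> p \<and> 0 \<le> q \<and> 2 \<le> length P \<and> M \<noteq> [] \<and> E \<noteq> [] \<and> hd M = hd F \<and> hd E = hd G \<and>
     hd P = (1, 0) \<and> last E = (0, 0) \<and> \<bar>fst (P ! 1) - 1\<bar> = int d \<and> snd (P ! 1) = 0 \<and>
     side (-1) a b (int l) P F M G E \<and> side 1 a' b' (int l - 1) P F M G E \<and>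
     all_steps p q (2 * int l - 2) P F M G E"

section \<open>Values and step sizes of the grown path\<close>

lemma mem_inst: "(c, k) \<in> set xs \<Longrightarrow> z = c + k * int t \<Longrightarrow> z \<in> set (inst t xs)"
  by (force simp: inst_def)

lemma steps_conv_nth:
  "steps xs = {(fst (xs ! i) - fst (xs ! (i + 1)), snd (xs ! i) - snd (xs ! (i + 1))) | i. i + 1 < length xs}
            \<union> {(fst (xs ! (i + 1)) - fst (xs ! i), snd (xs ! (i + 1)) - snd (xs ! i)) | i. i + 1 < length xs}"
  unfolding steps_def set_zip set_map
  by (simp add: nth_tl case_prod_beta setcompr_eq_image image_image less_diff_conv cong: conj_cong)

lemma mem_gaps_inst:
  assumes "(c, k) \<in> steps xs" and "g = c + k * int t" and "0 \<le> g"
  shows "g \<in> gaps (inst t xs)"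
proof -
  obtain i where i: "i + 1 < length xs" and
    "c = fst (xs ! i) - fst (xs ! (i + 1)) \<and> k = snd (xs ! i) - snd (xs ! (i + 1)) \<or>
     c = fst (xs ! (i + 1)) - fst (xs ! i) \<and> k = snd (xs ! (i + 1)) - snd (xs ! i)"
    using assms(1) unfolding steps_conv_nth by blast
  then have "g = \<bar>inst t xs ! (i + 1) - inst t xs ! i\<bar>"
    using assms(2,3) by (auto simp: inst_def case_prod_beta left_diff_distrib)
  moreover have "i + 1 < length (inst t xs)" using i by (simp add: inst_def)
  ultimately show ?thesis unfolding gaps_conv_nth by blast
qed

lemma inst_simps [simp]:
  "inst t [] = []" "inst t (x # xs) = (fst x + snd x * int t) # inst t xs"
  "inst t (xs @ ys) = inst t xs @ inst t ys" "length (inst t xs) = length xs"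
  "inst t xs = [] \<longleftrightarrow> xs = []"
  by (auto simp: inst_def case_prod_beta)

lemma hd_inst: "xs \<noteq> [] \<Longrightarrow> hd (inst t xs) = fst (hd xs) + snd (hd xs) * int t"
  by (cases xs) auto

text \<open>Isolates copy \<open>i\<close> together with the entry after it, so that the step
  leaving the copy is available too. The condition on \<open>hd R\<close> makes the last copy behave
  like the others.\<close>

lemma concat_copies_split:
  assumes "i \<in> {m..<n}" and "F \<noteq> []" and "R \<noteq> []" and "hd R = hd (inst n F)"
  shows "\<exists>us vs. concat (map (\<lambda>t. inst t F) [m..<n]) @ R = us @ inst i (F @ [next_copy F]) @ vs"
proof -
  define S where "S = concat (map (\<lambda>t. inst t F) [Suc i..<n]) @ R"
  have upt: "[m..<n] = [m..<i] @ i # [Suc i..<n]"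
    using assms(1) using upt_add_eq_append[of m i "n - i"] by (simp add: upt_conv_Cons)
  have "hd S = hd (inst (Suc i) F)"
  proof (cases "Suc i < n")
    case True
    then show ?thesis using assms(2) by (simp add: S_def upt_conv_Cons)
  next
    case False
    then have "n = Suc i" using assms(1) by simp
    then show ?thesis using assms(4) by (simp add: S_def)
  qed
  moreover have "S \<noteq> []" using assms(3) by (simp add: S_def)
  ultimately have "S = (fst (next_copy F) + snd (next_copy F) * int i) # tl S"
    using assms(2) by (cases S) (simp_all add: hd_inst next_copy_def algebra_simps)
  then have "concat (map (\<lambda>t. inst t F) [m..<n]) @ R =
      concat (map (\<lambda>t. inst t F) [m..<i]) @ inst i (F @ [next_copy F]) @ tl S"
    by (simp add: upt S_def)
  then show ?thesis by blast
qed

text \<open>Each copy supplies two integers per side and the next one lies 2 further out, so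
  \<open>m\<close> copies fill \<open>2 * m\<close> consecutive integers.\<close>

lemma side_cover:
  assumes "side s a b n P F M G E" and "s \<in> {1, -1}" and "0 \<le> w" and "w \<le> n + 4 * int m"
  shows "s * w = -2 \<or> s * w \<in> set (grow P F M G E m)"
proof -
  note side = assms(1)[unfolded side_def]
  consider (core) "w \<le> a" | (inner) "a < w" "w \<le> a + 2 * int m"
    | (middle) "a + 2 * int m < w" "w \<le> b + 2 * int m"
    | (outer) "b + 2 * int m < w" "w \<le> b + 4 * int m" | (rim) "b + 4 * int m < w"
    by linarith
  then show ?thesis
  proof cases
    case core
    then have "s * w = -2 \<or> (s * w, 0) \<in> set P \<union> set E" using side assms(3) by auto
    then show ?thesis by (auto simp: grow_def intro: mem_inst)
  next
    case inner
    define i where "i = nat ((w - a - 1) div 2)"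
    have i: "i < m" "w - 2 * int i \<in> {a+1..a+2}" using inner by (auto simp: i_def)
    then have "(s * (w - 2 * int i), 2 * s) \<in> set F" using side by blast
    then have "s * w \<in> set (inst i F)" by (rule mem_inst) (simp add: algebra_simps)
    with i(1) show ?thesis by (auto simp: grow_def)
  next
    case middle
    then have "(s * (w - 2 * int m), 2 * s) \<in> set M" using side by auto
    then have "s * w \<in> set (inst m M)" by (rule mem_inst) (simp add: algebra_simps)
    then show ?thesis by (simp add: grow_def)
  next
    case outer
    \<comment> \<open>The outer copies start at \<open>t = m\<close>, so counting from
      \<open>b\<close> instead of \<open>b + 2 * m\<close> gives the parameter itself.\<close>
    define i where "i = nat ((w - b - 1) div 2)"
    have i: "i \<in> {m..<2*m}" "w - 2 * int i \<in> {b+1..b+2}" using outer by (auto simp: i_def)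
    then have "(s * (w - 2 * int i), 2 * s) \<in> set G" using side by blast
    then have "s * w \<in> set (inst i G)" by (rule mem_inst) (simp add: algebra_simps)
    with i(1) show ?thesis by (auto simp: grow_def)
  next
    case rim
    then have "(s * (w - 4 * int m), 2 * s) \<in> set E" using side assms(4) by auto
    then have "s * w \<in> set (inst (2 * m) E)" by (rule mem_inst) (simp add: algebra_simps)
    then show ?thesis by (simp add: grow_def)
  qed
qed

text \<open>Each copy yields four consecutive sizes, all raised by 4 in the next copy, so
  \<open>m\<close> copies fill a band of \<open>4 * m\<close> sizes.\<close>

lemma all_steps_gaps:
  assumes "all_steps p q n P F M G E" and "1 \<le> g" and "g \<le> n + 8 * int m" and "0 \<le> p" and "0 \<le> q"
    and ne: "F \<noteq> []" "G \<noteq> []" "M \<noteq> []" "E \<noteq> []" and hd: "hd M = hd F" "hd E = hd G"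
  shows "g \<in> gaps (grow P F M G E m)"
proof -
  note steps = assms(1)[unfolded all_steps_def]
  let ?Fs = "concat (map (\<lambda>t. inst t F) [0..<m])" and ?Gs = "concat (map (\<lambda>t. inst t G) [m..<2*m])"
  have infix_gaps: "g \<in> gaps (grow P F M G E m)"
    if "g \<in> gaps ys" "grow P F M G E m = us @ ys @ vs" for ys us vs
    using that gaps_infix by auto
  let ?R = "inst m M @ ?Gs @ inst (2*m) E"
  have R: "?R \<noteq> []" "hd ?R = hd (inst m F)" using ne hd by (simp_all add: hd_inst)
  have E: "inst (2*m) E \<noteq> []" "hd (inst (2*m) E) = hd (inst (2*m) G)"
    using ne hd by (simp_all add: hd_inst)
  have P_part: "g \<in> gaps (grow P F M G E m)" if "(g, 0) \<in> steps (P @ [(fst (hd F), 0)])"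
  proof -
    \<comment> \<open>For \<open>m = 0\<close> the entry after \<open>P\<close> is the head of
      \<open>M\<close>, which agrees with that of \<open>F\<close>.\<close>
    have "hd (?Fs @ ?R) = hd (inst 0 F)"
      using R ne by (cases m) (simp_all add: upt_conv_Cons del: upt_Suc)
    then have "?Fs @ ?R = fst (hd F) # tl (?Fs @ ?R)"
      using R(1) ne by (cases "?Fs @ ?R") (auto simp: hd_inst)
    then have "grow P F M G E m = [] @ inst 0 (P @ [(fst (hd F), 0)]) @ tl (?Fs @ ?R)"
      by (simp add: grow_def)
    moreover have "g \<in> gaps (inst 0 (P @ [(fst (hd F), 0)]))"
      using mem_gaps_inst[OF that] assms(2) by simp
    ultimately show ?thesis by (rule infix_gaps[rotated])
  qed
  have M_part: "g \<in> gaps (grow P F M G E m)" if "(c, k) \<in> steps (M @ [hd G])" "g = c + k * int m" for c k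
  proof -
    have "hd (?Gs @ inst (2*m) E) = hd (inst m G)"
      using E ne by (cases m) (simp_all add: upt_conv_Cons del: upt_Suc)
    then have "?Gs @ inst (2*m) E = (fst (hd G) + snd (hd G) * int m) # tl (?Gs @ inst (2*m) E)"
      using E(1) ne by (cases "?Gs @ inst (2*m) E") (auto simp: hd_inst)
    then have "grow P F M G E m = (inst 0 P @ ?Fs) @ inst m (M @ [hd G]) @ tl (?Gs @ inst (2*m) E)"
      by (simp add: grow_def)
    moreover have "g \<in> gaps (inst m (M @ [hd G]))"
      using mem_gaps_inst[OF that] assms(2) by simp
    ultimately show ?thesis by (rule infix_gaps[rotated])
  qed
  have E_part: "g \<in> gaps (grow P F M G E m)" if "(c, k) \<in> steps E" "g = c + k * int (2 * m)" for c k
  proof (rule infix_gaps)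
    show "g \<in> gaps (inst (2 * m) E)" using mem_gaps_inst[OF that] assms(2) by simp
    show "grow P F M G E m = (inst 0 P @ ?Fs @ inst m M @ ?Gs) @ inst (2 * m) E @ []"
      by (simp add: grow_def)
  qed
  consider (core) "g \<le> p" | (inner) "p < g" "g \<le> p + 4 * int m"
    | (middle) "p + 4 * int m < g" "g \<le> q + 4 * int m"
    | (outer) "q + 4 * int m < g" "g \<le> q + 8 * int m" | (rim) "q + 8 * int m < g"
    by linarith
  then show ?thesis
  proof cases
    case core
    then have "(g, 0) \<in> steps (P @ [(fst (hd F), 0)]) \<union> steps (M @ [hd G]) \<union> steps E"
      using steps assms(2) by auto
    then show ?thesis using P_part M_part[of g 0] E_part[of g 0] by auto
  next
    case inner
    define i where "i = nat ((g - p - 1) div 4)"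
    have i: "i \<in> {0..<m}" "g - 4 * int i \<in> {p+1..p+4}" using inner by (auto simp: i_def)
    then have "(g - 4 * int i, 4) \<in> steps (F @ [next_copy F])" using steps by blast
    then have "g \<in> gaps (inst i (F @ [next_copy F]))"
      using assms(2) by (intro mem_gaps_inst[of "g - 4 * int i" 4]) auto
    moreover obtain us vs where "?Fs @ ?R = us @ inst i (F @ [next_copy F]) @ vs"
      using concat_copies_split[OF i(1) ne(1) R] by blast
    then have "grow P F M G E m = (inst 0 P @ us) @ inst i (F @ [next_copy F]) @ vs"
      by (simp add: grow_def)
    ultimately show ?thesis by (rule infix_gaps)
  next
    case middle
    then have "(g - 4 * int m, 4) \<in> steps (M @ [hd G]) \<or> (g - 4 * int m, 2) \<in> steps E"
      using steps by auto
    then show ?thesis using M_part[of "g - 4 * int m" 4] E_part[of "g - 4 * int m" 2] by auto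
  next
    case outer
    define i where "i = nat ((g - q - 1) div 4)"
    have i: "i \<in> {m..<2*m}" "g - 4 * int i \<in> {q+1..q+4}" using outer by (auto simp: i_def)
    then have "(g - 4 * int i, 4) \<in> steps (G @ [next_copy G])" using steps by blast
    then have "g \<in> gaps (inst i (G @ [next_copy G]))"
      using assms(2) by (intro mem_gaps_inst[of "g - 4 * int i" 4]) auto
    moreover obtain us vs where "?Gs @ inst (2*m) E = us @ inst i (G @ [next_copy G]) @ vs"
      using concat_copies_split[OF i(1) ne(2) E] by blast
    then have "grow P F M G E m = (inst 0 P @ ?Fs @ inst m M @ us) @ inst i (G @ [next_copy G]) @ vs"
      by (simp add: grow_def)
    ultimately show ?thesis by (rule infix_gaps)
  next
    case rim
    then have "(g - 8 * int m, 4) \<in> steps E" using steps assms(3) by auto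
    then show ?thesis using E_part[of "g - 8 * int m" 4] by simp
  qed
qed

lemma centred_grow:
  assumes "fits d l a b a' b' p q P F M G E"
  shows "centred d (l + 4 * m) (grow P F M G E m)"
proof -
  note fits = assms[unfolded fits_def]
  have ne: "P \<noteq> []" "F \<noteq> []" "M \<noteq> []" "G \<noteq> []" "E \<noteq> []" using fits by auto
  have len_copies: "length (concat (map (\<lambda>t. inst t X) [i..<j])) = 4 * (j - i)"
    if "length X = 4" for X i j
    using that by (simp add: length_concat comp_def sum_list_triv)
  \<comment> \<open>The \<open>2 * m\<close> copies of four entries account for the extra
    \<open>8 * m\<close>.\<close>
  have "length (grow P F M G E m) = 2 * (l + 4 * m) - 1"
    using fits by (simp add: grow_def len_copies) arith
  moreover have "hd (grow P F M G E m) = 1" using fits ne by (simp add: grow_def hd_inst)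
  moreover have "last (grow P F M G E m) = 0"
    using fits ne by (simp add: grow_def inst_def last_map)
  moreover have "\<bar>grow P F M G E m ! 1 - 1\<bar> = int d"
    using fits by (auto simp: grow_def nth_append inst_def case_prod_beta)
  moreover have "z = -2 \<or> z \<in> set (grow P F M G E m)"
    if "z \<in> {- int (l + 4 * m) .. int (l + 4 * m) - 1}" for z
  proof (cases "0 \<le> z")
    case True
    then show ?thesis using side_cover[of 1 a' b' "int l - 1" P F M G E z m] fits that by auto
  next
    case False
    then show ?thesis using side_cover[of "-1" a b "int l" P F M G E "-z" m] fits that by auto
  qed
  moreover have "g \<in> gaps (grow P F M G E m)" if "g \<in> {1 .. 2 * int (l + 4 * m) - 2}" for g
    using all_steps_gaps[of p q "2 * int l - 2" P F M G E g m] fits ne that by auto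
  ultimately show ?thesis unfolding centred_def by blast
qed

section \<open>The pieces for each first difference and residue of \<open>l\<close> modulo 4\<close>

text \<open>At \<open>t = 0\<close> the inner zigzag visits 3, -7, 2, -6 and then 5, with steps 10,
  9, 8, 11; hence \<open>a = 5\<close>, \<open>a' = 1\<close>, \<open>p = 7\<close>. The outer
  zigzag gives \<open>b\<close>, \<open>b'\<close>, \<open>q\<close> likewise.\<close>

lemma fits_5_16:
  "fits 5 16 5 10 1 10 7 21
    [(1, 0), (-4, 0)]
    [(3, 2), (-7, -2), (2, 2), (-6, -2)]
    [(3, 2), (-7, -2), (2, 2), (-6, -2), (5, 2), (8, 2), (7, 2), (-10, -2), (10, 2), (4, 2), (-8,
     -2), (6, 2), (-9, -2), (9, 2)]
    [(-12, -2), (12, 2), (-11, -2), (11, 2)]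
    [(-12, -2), (12, 2), (-11, -2), (11, 2), (-14, -2), (15, 2), (-15, -2), (13, 2), (-13, -2),
     (14, 2), (-5, 0), (-1, 0), (-3, 0), (-16, -2), (0, 0)]"
  by code_simp

lemma fits_5_18:
  "fits 5 18 4 11 3 11 8 23
    [(1, 0), (-4, 0), (3, 0), (-3, 0)]
    [(5, 2), (-6, -2), (4, 2), (-5, -2)]
    [(5, 2), (-6, -2), (4, 2), (-5, -2), (7, 2), (-7, -2), (6, 2), (10, 2), (-11, -2), (11, 2),
     (8, 2), (-8, -2), (-9, -2), (9, 2), (-10, -2)]
    [(13, 2), (-13, -2), (12, 2), (-12, -2)]
    [(13, 2), (-13, -2), (12, 2), (-12, -2), (15, 2), (-15, -2), (14, 2), (-14, -2), (17, 2),
     (-17, -2), (16, 2), (-16, -2), (-1, 0), (-18, -2), (2, 0), (0, 0)]"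
  by code_simp

lemma fits_6_16:
  "fits 6 16 5 9 1 9 7 19
    [(1, 0), (-5, 0)]
    [(2, 2), (-6, -2), (3, 2), (-7, -2)]
    [(2, 2), (-6, -2), (3, 2), (-7, -2), (4, 2), (9, 2), (5, 2), (-8, -2), (6, 2), (7, 2), (-9,
     -2), (8, 2)]
    [(-10, -2), (10, 2), (-11, -2), (11, 2)]
    [(-10, -2), (10, 2), (-11, -2), (11, 2), (-12, -2), (12, 2), (-13, -2), (13, 2), (-14, -2),
     (14, 2), (-15, -2), (15, 2), (-4, 0), (-16, -2), (-1, 0), (-3, 0), (0, 0)]"
  by code_simp

lemma fits_6_18:
  "fits 6 18 5 13 1 13 7 27
    [(1, 0), (-5, 0)]
    [(2, 2), (-6, -2), (3, 2), (-7, -2)]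
    [(2, 2), (-6, -2), (3, 2), (-7, -2), (4, 2), (-8, -2), (5, 2), (9, 2), (-10, -2), (8, 2), (7,
     2), (-9, -2), (6, 2), (11, 2), (-12, -2), (10, 2), (-11, -2), (13, 2), (-13, -2), (12, 2)]
    [(-15, -2), (15, 2), (-14, -2), (14, 2)]
    [(-15, -2), (15, 2), (-14, -2), (14, 2), (-17, -2), (17, 2), (-16, -2), (16, 2), (-4, 0),
     (-18, -2), (-1, 0), (-3, 0), (0, 0)]"
  by code_simp

lemma fits_7_20:
  "fits 7 20 6 12 1 11 8 24
    [(1, 0), (-6, 0)]
    [(2, 2), (-7, -2), (3, 2), (-8, -2)]
    [(2, 2), (-7, -2), (3, 2), (-8, -2), (4, 2), (-9, -2), (5, 2), (11, 2), (6, 2), (-10, -2), (7,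
     2), (-11, -2), (8, 2), (-12, -2), (9, 2), (10, 2)]
    [(-13, -2), (12, 2), (-14, -2), (13, 2)]
    [(-13, -2), (12, 2), (-14, -2), (13, 2), (-15, -2), (14, 2), (-16, -2), (15, 2), (-17, -2),
     (16, 2), (-18, -2), (17, 2), (-19, -2), (18, 2), (-20, -2), (-5, 0), (19, 2), (-3, 0), (-1,
     0), (-4, 0), (0, 0)]"
  by code_simp

lemma fits_7_18:
  "fits 7 18 6 11 1 10 8 22
    [(1, 0), (-6, 0)]
    [(2, 2), (-7, -2), (3, 2), (-8, -2)]
    [(2, 2), (-7, -2), (3, 2), (-8, -2), (4, 2), (10, 2), (6, 2), (-10, -2), (5, 2), (-9, -2), (8,
     2), (7, 2), (-11, -2), (9, 2)]
    [(-13, -2), (12, 2), (-12, -2), (11, 2)]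
    [(-13, -2), (12, 2), (-12, -2), (11, 2), (-15, -2), (14, 2), (-14, -2), (13, 2), (-17, -2),
     (17, 2), (-4, 0), (-1, 0), (-3, 0), (16, 2), (-16, -2), (15, 2), (-18, -2), (-5, 0), (0, 0)]"
  by code_simp

section \<open>Explicit short paths, and existence for each first difference\<close>

lemma centred_5_small:
  "centred 5 4 [1, -4, -3, 3, -1, 2, 0]"
  "centred 5 6 [1, -4, -1, -3, 3, -6, 2, -5, 5, 4, 0]"
  "centred 5 8 [1, -4, 5, -8, 4, -6, 2, -1, 3, -3, -5, 6, 7, -7, 0]"
  "centred 5 10 [1, -4, 7, -10, 6, -8, -1, -3, 3, 4, -6, 2, 5, -7, 8, -5, -9, 9, 0]"
  "centred 5 12 [1, -4, -11, 11, -3, 7, -9, 10, -7, -1, -5, 6, 9, -12, 8, -10, 5, -8, 4, 3, -6, 2,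
   0]"
  "centred 5 14 [1, -4, -7, -3, 5, 6, -9, 12, -11, 9, -5, 13, -13, -1, -8, 8, 2, 4, -6, 3, -10, 7,
   -12, 10, -14, 11, 0]"
  by code_simp+

lemma ex_centred_5:
  assumes "even l" "l > 2"
  shows "\<exists>zs. centred 5 l zs"
proof -
  \<comment> \<open>The bases 16 and 18 represent the two even residues modulo 4.\<close>
  have "l \<in> {4, 6, 8, 10, 12, 14} \<or> (\<exists>m. l = 16 + 4 * m) \<or> (\<exists>m. l = 18 + 4 * m)"
    using assms by simp presburger
  then show ?thesis
    by (elim disjE exE) (use centred_5_small centred_grow[OF fits_5_16] centred_grow[OF fits_5_18] in auto)
qed

lemma centred_6_small:
  "centred 6 6 [1, -5, 5, -3, -4, 3, -6, -1, 2, 4, 0]"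
  "centred 6 8 [1, -5, 6, -3, -7, 7, -1, 2, 3, -4, -6, 4, -8, 5, 0]"
  "centred 6 10 [1, -5, 8, -7, -6, 3, 5, 2, -9, 9, -3, 7, -10, 6, -8, -1, 4, -4, 0]"
  "centred 6 12 [1, -5, 6, -3, 11, -11, -4, -7, 10, -9, 7, 3, 4, -8, 5, -10, 8, -12, 9, -1, -6, 2,
   0]"
  "centred 6 14 [1, -5, 13, -13, 3, -7, 6, -9, 12, -11, 9, 2, 5, -4, -3, 8, 4, -10, 7, -12, 10,
   -14, 11, -1, -6, -8, 0]"
  by code_simp+

lemma ex_centred_6:
  assumes "even l" "l > 4"
  shows "\<exists>zs. centred 6 l zs"
proof -
  have "l \<in> {6, 8, 10, 12, 14} \<or> (\<exists>m. l = 16 + 4 * m) \<or> (\<exists>m. l = 18 + 4 * m)"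
    using assms by simp presburger
  then show ?thesis
    by (elim disjE exE) (use centred_6_small centred_grow[OF fits_6_16] centred_grow[OF fits_6_18] in auto)
qed

lemma centred_7_small:
  "centred 7 6 [1, -6, 3, -5, 5, 2, -4, -3, -1, 4, 0]"
  "centred 7 8 [1, -6, 4, -8, 5, 3, 2, -4, -1, 7, -7, -3, 6, -5, 0]"
  "centred 7 10 [1, -6, 4, 2, 5, -7, 8, -5, -4, 7, -10, 6, -8, -3, 3, -1, -9, 9, 0]"
  "centred 7 12 [1, -6, 2, 7, -9, 10, -7, 3, -1, -4, -3, 11, -11, -5, 6, 4, -8, 5, -10, 8, -12, 9,
   0]"
  "centred 7 14 [1, -6, -3, 5, 4, -1, -13, 13, -5, 9, -11, 12, -9, 6, 8, -8, -4, 2, -7, 3, -10, 7,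
   -12, 10, -14, 11, 0]"
  "centred 7 16 [1, -6, 11, -13, 14, -11, 8, -10, 10, -3, 13, -16, 12, -14, 9, -12, -9, -4, 7, 6,
   -8, 2, 4, -5, 3, -1, 5, -7, 15, -15, 0]"
  by code_simp+

lemma ex_centred_7:
  assumes "even l" "l > 4"
  shows "\<exists>zs. centred 7 l zs"
proof -
  \<comment> \<open>Here the family for residue 0 starts only at 20, so 16 joins the explicit
    cases.\<close>
  have "l \<in> {6, 8, 10, 12, 14, 16} \<or> (\<exists>m. l = 18 + 4 * m) \<or> (\<exists>m. l = 20 + 4 * m)"
    using assms by simp presburger
  then show ?thesis
    by (elim disjE exE) (use centred_7_small centred_grow[OF fits_7_18] centred_grow[OF fits_7_20] in auto)
qed

theorem theorem5p12:
  fixes d l :: nat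
  assumes "d \<in> {5,6,7}" and "even l" and "l > 2"
    and "\<not> (l = 4 \<and> d \<in> {6,7})"
  shows "\<exists>xs. cracked_graceful (2*l - 1) xs \<and> has_crack (2*l - 1) xs (l - 2)
              \<and> xs ! 0 = l + 1 \<and> last xs = l \<and> absdiff (xs ! 1) (xs ! 0) = d"
proof -
  have "l > 4" if "d \<noteq> 5"
  proof -
    have "l \<noteq> 3" "l \<noteq> 4" using assms that by auto
    with \<open>l > 2\<close> show ?thesis by simp
  qed
  then have "\<exists>zs. centred d l zs"
    using assms(1-3) ex_centred_5 ex_centred_6 ex_centred_7 by auto
  then obtain zs where "centred d l zs" ..
  from cracked_graceful_of_centred[OF this \<open>l > 2\<close>] show ?thesis by blast
qed

end
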